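(* Let $d$ be a dimension. There is no subshift $S\neq\emptyset$ (in a finite alphabet) such that for every subshift $M$ that is existentially closed for consistent systems in dimension $d$, $S \mathrel{\underset{\sim}{\sqsubset}} M$.
   Context: Subshifts. For an alphabet $\Sigma$ (possibly infinite) and $d<\omega$, $\Sigma^{\mathbb{Z}^d}$ carries the product topology with $\Sigma$ discrete, and the shift map is $\mathrm{sh}(v,x)(u)=x(u+v)$. A subshift $S$ is a closed, shift-invariant subset of some $\Sigma^{\mathbb{Z}^d}$; $\Sigma_S=\Sigma$ is its alphabet, $d_S=d$ its dimension. Words and languages. A ($d$-dimensional) word over $\Sigma$ is a map from a rectangle $[m_0,n_0]\times\cdots\times[m_{d-1},n_{d-1}]\subseteq\mathbb{Z}^d$ to $\Sigma$; $\Sigma^{*d}$ is the set of these. For $k<d$, $\mathbb{Z}^k\subseteq\mathbb{Z}^d$ by padding with zeros in the last coordinates, so $\Sigma^{*k}\subseteq\Sigma^{*d}$. $\mathcal{L}^c(S)$ is the set of $w\in\Sigma_S^{*d_S}$ with $x\restriction_{\mathrm{dom}(w)}\neq w$ for all $x\in S$, and $\mathcal{L}(S)=\Sigma_S^{*d_S}\setminus\mathcal{L}^c(S)$. $S\models L(G)\wedge L^c(B)$ means $G\subseteq\mathcal{L}(S)$ and $B\subseteq\mathcal{L}^c(S)$. Embeddings. $S\sqsubseteq T$ means $\Sigma_S\subseteq\Sigma_T$, $d_S\le d_T$ and $\mathcal{L}(T)\cap\Sigma_S^{*d_S}=\mathcal{L}(S)$. $S\mathrel{\underset{\sim}{\sqsubset}}T$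 means there is an injective map $\hat f:\Sigma_S\hookrightarrow\Sigma_T$ such that $f(S)\sqsubseteq T$, where $f$ applies $\hat f$ letterwise and $f(S)$ is regarded as a subshift in alphabet $\hat f(\Sigma_S)$. Existential closure. Write $U(\overline{x},\overline{a})$ for a set of words whose letters come from the tuple $\overline{a}$ of letters of a given alphabet $\Sigma$ and the tuple $\overline{x}$ of "variable" letters from a set $X$ disjoint from $\Sigma$; $U(\overline{b},\overline{a})$ is the result of substituting $\overline{b}$ for $\overline{x}$. The expression $\exists\overline{x}\,(L(G(\overline{x},\overline{a}))\wedge L^c(B(\overline{x},\overline{a})))$ is consistent with a subshift $T$ if $\overline{a}\subseteq\Sigma_T$ and there are a subshift $S\sqsupseteq T$ and $\overline{b}\subseteq\Sigma_S$ with $S\models L(G(\overline{b},\overline{a}))\wedge L^c(B(\overline{b},\overline{a}))$; in this case $L(G(\overline{x},\overline{a}))\wedge L^c(B(\overline{x},\overline{a}))$ is said to be satisfied in $S$. A subshift $M$ in alphabet $\Sigma$ (of dimension $d$) is existentially closed for consistent systems in dimension $d$ if for every pair of finite sets $U(\overline{x},\overline{a})$, $V(\overline{x},\overline{a})$ of words in $(\Sigma\cup X)^{*d}$, if $\exists\overline{x}\,(L(U(\overline{x},\overline{a}))\wedge L^c(V(\overline{x},\overline{a})))$ is consistent with $M$, then $L(U(\overline{x},\overline{a}))\wedge L^c(V(\overline{x},\overline{a}))$ is satisfied in $M$. Here the alphabet of $M$ is not assumed finite.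
   Formalization: The subshift S is required to have dimension at least 1; in dimension 0 the claim fails, since the one-point subshift over a one-letter alphabet embeds in every existentially closed M. *)

theory Defs
  imports "HOL-Analysis.Analysis" "HOL-Library.Infinite_Typeclass"
begin

text \<open>
  Points of all the groups \<open>\<int>\<^sup>d\<close> live in one type, padded with zeros from index \<open>d\<close> on,
  so that \<open>\<int>\<^sup>k \<subseteq> \<int>\<^sup>d\<close> for \<open>k \<le> d\<close> is a literal inclusion.
\<close>

type_synonym point = "nat \<Rightarrow> int"

definition Zd :: "nat \<Rightarrow> point set" where
  "Zd d = {u. \<forall>i\<ge>d. u i = 0}"

definition padd :: "point \<Rightarrow> point \<Rightarrow> point" where
  "padd u v = (\<lambda>i. u i + v i)"


subsection \<open>Subshifts\<close>

text \<open>Configurations are extensional functions, i.e. \<^const>\<open>undefined\<close> outside \<open>Zd d\<close>.\<close>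

record 'a shift_space =
  alphabet :: "'a set"
  sdim :: nat
  points :: "(point \<Rightarrow> 'a) set"

definition shift :: "nat \<Rightarrow> point \<Rightarrow> (point \<Rightarrow> 'a) \<Rightarrow> point \<Rightarrow> 'a" where
  "shift d v x = (\<lambda>u\<in>Zd d. x (padd u v))"

definition subshift :: "'a shift_space \<Rightarrow> bool" where
  "subshift S \<longleftrightarrow>
     closedin (product_topology (\<lambda>_. discrete_topology (alphabet S)) (Zd (sdim S))) (points S) \<and>
     (\<forall>v \<in> Zd (sdim S). \<forall>x \<in> points S. shift (sdim S) v x \<in> points S)"

text \<open>The result of applying \<open>f\<close> letterwise, as a space with alphabet \<open>f ` alphabet S\<close>.\<close>

definition relabel :: "('a \<Rightarrow> 'b) \<Rightarrow> 'a shift_space \<Rightarrow> 'b shift_space" where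
  "relabel f S =
     \<lparr>alphabet = f ` alphabet S, sdim = sdim S,
      points = (\<lambda>x. \<lambda>u\<in>Zd (sdim S). f (x u)) ` points S\<rparr>"


subsection \<open>Words and languages\<close>

type_synonym 'a word = "point \<Rightarrow> 'a option"

definition rect :: "nat \<Rightarrow> point \<Rightarrow> point \<Rightarrow> point set" where
  "rect d m n = {u \<in> Zd d. \<forall>i<d. m i \<le> u i \<and> u i \<le> n i}"

text \<open>
  Rectangles are nonempty. With an empty word the empty subshift, whose language would then omit
  it, would have no nonempty extension and would be existentially closed.
\<close>

definition words :: "'a set \<Rightarrow> nat \<Rightarrow> 'a word set" where
  "words A d = {w. (\<exists>m n. (\<forall>i<d. m i \<le> n i) \<and> dom w = rect d m n) \<and> ran w \<subseteq> A}"

definition colang :: "'a shift_space \<Rightarrow> 'a word set" where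
  "colang S = {w \<in> words (alphabet S) (sdim S). \<forall>x \<in> points S. (\<lambda>u. Some (x u)) |` dom w \<noteq> w}"

definition lang :: "'a shift_space \<Rightarrow> 'a word set" where
  "lang S = words (alphabet S) (sdim S) - colang S"

definition models :: "'a shift_space \<Rightarrow> 'a word set \<Rightarrow> 'a word set \<Rightarrow> bool" where
  "models S G B \<longleftrightarrow> G \<subseteq> lang S \<and> B \<subseteq> colang S"


subsection \<open>Embeddings\<close>

definition extended_by :: "'a shift_space \<Rightarrow> 'a shift_space \<Rightarrow> bool" (infix \<open>\<sqsubseteq>\<close> 50) where
  "S \<sqsubseteq> T \<longleftrightarrow>
     alphabet S \<subseteq> alphabet T \<and> sdim S \<le> sdim T \<and>
     lang T \<inter> words (alphabet S) (sdim S) = lang S"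

definition embeds_in :: "'a shift_space \<Rightarrow> 'b shift_space \<Rightarrow> bool" (infix \<open>\<lesssim>\<close> 50) where
  "S \<lesssim> T \<longleftrightarrow> (\<exists>f. inj_on f (alphabet S) \<and> relabel f S \<sqsubseteq> T)"


subsection \<open>Existential closure\<close>

text \<open>
  A system is a pair of sets of words over \<open>'a + nat\<close>: a letter \<open>Inl a\<close> is the constant \<open>a\<close>,
  a letter \<open>Inr i\<close> is the \<open>i\<close>-th variable.
\<close>

definition subst :: "('a \<Rightarrow> 'b) \<Rightarrow> 'a word \<Rightarrow> 'b word" where
  "subst f w = map_option f \<circ> w"

definition sys_vars :: "('a + nat) word set \<Rightarrow> nat set" where
  "sys_vars W = {i. \<exists>w \<in> W. Inr i \<in> ran w}"

definition sys_consts :: "('a + nat) word set \<Rightarrow> 'a set" where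
  "sys_consts W = {a. \<exists>w \<in> W. Inl a \<in> ran w}"

text \<open>
  The map \<open>\<iota>\<close> interprets the constants, and \<open>\<beta>\<close> is the tuple substituted for the variables.
\<close>

definition satisfied ::
  "('a \<Rightarrow> 'b) \<Rightarrow> 'b shift_space \<Rightarrow> ('a + nat) word set \<Rightarrow> ('a + nat) word set \<Rightarrow> bool" where
  "satisfied \<iota> S U V \<longleftrightarrow>
     (\<exists>\<beta>. \<beta> ` sys_vars (U \<union> V) \<subseteq> alphabet S \<and>
          models S (subst (case_sum \<iota> \<beta>) ` U) (subst (case_sum \<iota> \<beta>) ` V))"

text \<open>
  The alphabet of \<open>T\<close> may exhaust its type, so an extension of \<open>T\<close> is taken over the letters
  \<open>'a + nat\<close>, where \<open>T\<close> itself is identified with its copy under \<open>Inl\<close>. For the finite systems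
  considered below, countably many new letters are as good as any number of them: by
  \<open>consistentI_any_extension\<close> below, an extension with letters of any other type would do.
\<close>

definition consistent ::
  "'a shift_space \<Rightarrow> ('a + nat) word set \<Rightarrow> ('a + nat) word set \<Rightarrow> bool" where
  "consistent T U V \<longleftrightarrow>
     sys_consts (U \<union> V) \<subseteq> alphabet T \<and>
     (\<exists>S :: ('a + nat) shift_space.
        subshift S \<and> relabel Inl T \<sqsubseteq> S \<and> satisfied Inl S U V)"

definition existentially_closed :: "nat \<Rightarrow> 'a shift_space \<Rightarrow> bool" where
  "existentially_closed d M \<longleftrightarrow>
     subshift M \<and> sdim M = d \<and>
     (\<forall>U V. finite U \<and> finite V \<and> U \<union> V \<subseteq> words (alphabet M <+> UNIV) d \<and> consistent M U V
        \<longrightarrow> satisfied id M U V)"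


subsection \<open>Countably many new letters suffice\<close>

lemma points_PiE: "subshift S \<Longrightarrow> x \<in> points S \<Longrightarrow> x \<in> Zd (sdim S) \<rightarrow>\<^sub>E alphabet S"
  unfolding subshift_def using closedin_subset by fastforce

lemma restrict_eq_iff: "(\<lambda>u. Some (x u)) |` dom w = w \<longleftrightarrow> (\<forall>u\<in>dom w. w u = Some (x u))"
proof
  assume eq: "(\<lambda>u. Some (x u)) |` dom w = w"
  show "\<forall>u\<in>dom w. w u = Some (x u)"
  proof
    fix u assume "u \<in> dom w"
    then show "w u = Some (x u)" using fun_cong[OF eq, of u] by simp
  qed
qed (auto simp: restrict_map_def fun_eq_iff domIff)

lemma lang_iff:
  "w \<in> lang S \<longleftrightarrow>
     w \<in> words (alphabet S) (sdim S) \<and> (\<exists>x\<in>points S. \<forall>u\<in>dom w. w u = Some (x u))"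
  by (auto simp: lang_def colang_def restrict_eq_iff)

lemma colang_iff:
  "w \<in> colang S \<longleftrightarrow> w \<in> words (alphabet S) (sdim S) \<and> w \<notin> lang S"
  by (auto simp: lang_def colang_def)

lemma dom_subst [simp]: "dom (subst f w) = dom w"
  by (auto simp: subst_def dom_def)

lemma ran_subst [simp]: "ran (subst f w) = f ` ran w"
  by (auto simp: subst_def ran_def image_iff)

lemma subst_subst: "subst f (subst g w) = subst (f \<circ> g) w"
  by (auto simp: subst_def fun_eq_iff option.map_comp)

lemma subst_Some: "w u = Some a \<Longrightarrow> subst f w u = Some (f a)"
  by (simp add: subst_def)

lemma Zd_mono: "d \<le> d' \<Longrightarrow> Zd d \<subseteq> Zd d'"
  by (auto simp: Zd_def)

lemma rect_subset_Zd: "rect d m n \<subseteq> Zd d"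
  by (auto simp: rect_def)

lemma dom_words: "w \<in> words A d \<Longrightarrow> dom w \<subseteq> Zd d"
  using rect_subset_Zd unfolding words_def by blast

lemma rect_mono:
  assumes "d \<le> d'"
  shows "rect d m n = rect d' (\<lambda>i. if i < d then m i else 0) (\<lambda>i. if i < d then n i else 0)"
proof (intro equalityI subsetI)
  fix u assume u: "u \<in> rect d' (\<lambda>i. if i < d then m i else 0) (\<lambda>i. if i < d then n i else 0)"
  have "u i = 0" if "i \<ge> d" for i
    using u that by (cases "i < d'") (force simp: rect_def Zd_def)+
  moreover have "m i \<le> u i \<and> u i \<le> n i" if "i < d" for i
  proof -
    have "\<forall>j<d'. (if j < d then m j else 0) \<le> u j \<and> u j \<le> (if j < d then n j else 0)"
      using u by (simp add: rect_def)
    from spec[OF this, of i] show ?thesis using that assms by simp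
  qed
  ultimately show "u \<in> rect d m n" by (auto simp: rect_def Zd_def)
qed (use assms in \<open>auto simp: rect_def Zd_def\<close>)

lemma words_mono: "A \<subseteq> A' \<Longrightarrow> d \<le> d' \<Longrightarrow> words A d \<subseteq> words A' d'"
proof
  fix w assume a: "A \<subseteq> A'" "d \<le> d'" "w \<in> words A d"
  then obtain m n where mn: "\<forall>i<d. m i \<le> n i" "dom w = rect d m n" "ran w \<subseteq> A"
    by (auto simp: words_def)
  show "w \<in> words A' d'"
    unfolding words_def mem_Collect_eq
  proof (intro conjI exI)
    show "dom w = rect d' (\<lambda>i. if i < d then m i else 0) (\<lambda>i. if i < d then n i else 0)"
      using mn rect_mono a by metis
  qed (use mn a in auto)
qed

lemma subst_words: "w \<in> words A d \<Longrightarrow> f ` A \<subseteq> B \<Longrightarrow> subst f w \<in> words B d"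
  unfolding words_def by auto

lemma countable_Zd: "countable (Zd d)"
proof -
  have "countable (PiE {..<d} (\<lambda>_. UNIV :: int set))"
    by (intro countable_PiE) auto
  moreover have "Zd d \<subseteq> (\<lambda>f i. if i < d then f i else 0) ` (PiE {..<d} (\<lambda>_. UNIV :: int set))"
  proof
    fix u assume "u \<in> Zd d"
    then have "u = (\<lambda>f i. if i < d then f i else 0) (restrict u {..<d})"
      by (auto simp: Zd_def fun_eq_iff)
    moreover have "restrict u {..<d} \<in> PiE {..<d} (\<lambda>_. UNIV :: int set)" by auto
    ultimately show "u \<in> (\<lambda>f i. if i < d then f i else 0) ` (PiE {..<d} (\<lambda>_. UNIV :: int set))"
      by (rule image_eqI)
  qed
  ultimately show ?thesis by (meson countable_image countable_subset)
qed

lemma finite_rect: "finite (rect d m n)"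
proof -
  have "finite (PiE {..<d} (\<lambda>i. {m i..n i}))"
    by (intro finite_PiE) auto
  moreover have "rect d m n \<subseteq> (\<lambda>f i. if i < d then f i else 0) ` (PiE {..<d} (\<lambda>i. {m i..n i}))"
  proof
    fix u assume u: "u \<in> rect d m n"
    then have "u = (\<lambda>f i. if i < d then f i else 0) (restrict u {..<d})"
      by (auto simp: rect_def Zd_def fun_eq_iff)
    moreover have "restrict u {..<d} \<in> PiE {..<d} (\<lambda>i. {m i..n i})"
      using u by (auto simp: rect_def)
    ultimately show "u \<in> (\<lambda>f i. if i < d then f i else 0) ` (PiE {..<d} (\<lambda>i. {m i..n i}))"
      by (rule image_eqI)
  qed
  ultimately show ?thesis by (meson finite_imageI finite_subset)
qed

lemma lang_relabel: "subst f w \<in> lang (relabel f M)" if "w \<in> lang M"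
proof -
  from that obtain x where w: "w \<in> words (alphabet M) (sdim M)"
    and x: "x \<in> points M" "\<forall>u\<in>dom w. w u = Some (x u)"
    by (auto simp: lang_iff)
  show ?thesis
    unfolding lang_iff
  proof (intro conjI bexI)
    show "subst f w \<in> words (alphabet (relabel f M)) (sdim (relabel f M))"
      using w by (auto simp: relabel_def intro: subst_words)
    show "(\<lambda>u\<in>Zd (sdim M). f (x u)) \<in> points (relabel f M)"
      using x by (auto simp: relabel_def)
    show "\<forall>u\<in>dom (subst f w). subst f w u = Some ((\<lambda>u\<in>Zd (sdim M). f (x u)) u)"
      using x dom_words[OF w] by (auto simp: subst_Some)
  qed
qed

lemma lang_relabelD:
  assumes "subshift M" "w \<in> lang (relabel f M)"
  obtains w0 where "w0 \<in> lang M" "w = subst f w0"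
proof -
  obtain x where w: "w \<in> words (f ` alphabet M) (sdim M)"
    and x: "x \<in> points M" "\<forall>u\<in>dom w. w u = Some ((\<lambda>u\<in>Zd (sdim M). f (x u)) u)"
    using assms by (auto simp: lang_iff relabel_def)
  define w0 where "w0 = (\<lambda>u. Some (x u)) |` dom w"
  have d: "dom w \<subseteq> Zd (sdim M)" by (rule dom_words[OF w])
  have dom0: "dom w0 = dom w" by (auto simp: w0_def)
  have "w = subst f w0"
  proof
    fix u show "w u = subst f w0 u"
      using x(2) d by (cases "u \<in> dom w") (auto simp: w0_def subst_def domIff)
  qed
  moreover have "ran w0 \<subseteq> alphabet M"
    using points_PiE[OF assms(1) x(1)] d by (auto simp: w0_def ran_def restrict_map_def split: if_splits)
  then have "w0 \<in> words (alphabet M) (sdim M)"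
    using w dom0 unfolding words_def by auto
  then have "w0 \<in> lang M"
    unfolding lang_iff using x(1) by (auto simp: w0_def)
  ultimately show thesis using that by blast
qed

lemma subst_inj_on:
  assumes "inj_on f A" "ran w \<subseteq> A" "ran w' \<subseteq> A" "subst f w = subst f w'"
  shows "w = w'"
proof
  fix u
  have "map_option f (w u) = map_option f (w' u)"
    using assms(4) by (metis comp_apply subst_def)
  then show "w u = w' u"
    using assms(1-3) by (cases "w u"; cases "w' u") (auto dest: inj_onD simp: subset_iff ranI)
qed

text \<open>
  The pullback of the \<open>d\<close>-dimensional slices of \<open>S\<close> along a letter map \<open>g\<close> to the alphabet \<open>A\<close>;
  \<open>g\<close> need not be injective.
\<close>

definition pullback :: "('b \<Rightarrow> 'c) \<Rightarrow> 'b set \<Rightarrow> nat \<Rightarrow> 'c shift_space \<Rightarrow> 'b shift_space" where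
  "pullback g A d S =
     \<lparr>alphabet = A, sdim = d,
      points = {x \<in> Zd d \<rightarrow>\<^sub>E A. \<forall>m n. \<exists>y\<in>points S. \<forall>u\<in>rect d m n. y u = g (x u)}\<rparr>"

lemma subshift_pullback:
  assumes S: "subshift S" and d: "d \<le> sdim S"
  shows "subshift (pullback g A d S)"
proof -
  let ?P = "points (pullback g A d S)"
  let ?T = "product_topology (\<lambda>_. discrete_topology A) (Zd d)"
  have "openin ?T ((Zd d \<rightarrow>\<^sub>E A) - ?P)"
  proof (subst openin_subopen, intro ballI)
    fix x assume x: "x \<in> (Zd d \<rightarrow>\<^sub>E A) - ?P"
    then obtain m n where mn: "\<not> (\<exists>y\<in>points S. \<forall>u\<in>rect d m n. y u = g (x u))"
      by (auto simp: pullback_def)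
    define X where "X = (\<lambda>u. if u \<in> rect d m n then {x u} else A)"
    have "openin ?T (PiE (Zd d) X)"
    proof (rule product_topology_basis)
      show "openin (discrete_topology A) (X u)" for u
        using x rect_subset_Zd[of d m n] by (auto simp: X_def)
      have "{u. X u \<noteq> topspace (discrete_topology A)} \<subseteq> rect d m n"
        by (auto simp: X_def)
      then show "finite {u. X u \<noteq> topspace (discrete_topology A)}"
        using finite_rect finite_subset by blast
    qed
    moreover have "x \<in> PiE (Zd d) X" using x by (auto simp: X_def PiE_iff)
    moreover have "PiE (Zd d) X \<subseteq> (Zd d \<rightarrow>\<^sub>E A) - ?P"
    proof
      fix z assume z: "z \<in> PiE (Zd d) X"
      have eq: "z u = x u" if "u \<in> rect d m n" for u
        using z that rect_subset_Zd[of d m n] by (force simp: X_def PiE_iff)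
      have "z \<in> Zd d \<rightarrow>\<^sub>E A"
        using z x by (auto simp: X_def PiE_iff split: if_splits)
      moreover have "z \<notin> ?P"
      proof
        assume "z \<in> ?P"
        then have "\<exists>y\<in>points S. \<forall>u\<in>rect d m n. y u = g (z u)" by (simp add: pullback_def)
        then show False using mn eq by simp
      qed
      ultimately show "z \<in> (Zd d \<rightarrow>\<^sub>E A) - ?P" by blast
    qed
    ultimately show "\<exists>W. openin ?T W \<and> x \<in> W \<and> W \<subseteq> (Zd d \<rightarrow>\<^sub>E A) - ?P" by blast
  qed
  then have "closedin ?T ?P"
    unfolding closedin_def by (auto simp: pullback_def)
  moreover have "shift d v x \<in> ?P" if v: "v \<in> Zd d" and x: "x \<in> ?P" for v x
  proof -
    have padd: "padd u v \<in> Zd d" if "u \<in> Zd d" for u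
      using that v by (auto simp: Zd_def padd_def)
    have "shift d v x \<in> Zd d \<rightarrow>\<^sub>E A"
      using x padd by (auto simp: shift_def pullback_def)
    moreover have "\<exists>y\<in>points S. \<forall>u\<in>rect d m n. y u = g (shift d v x u)" for m n
    proof -
      obtain y where y: "y \<in> points S" "\<forall>u\<in>rect d (padd m v) (padd n v). y u = g (x u)"
        using x unfolding pullback_def by simp meson
      have "v \<in> Zd (sdim S)" using v d Zd_mono by blast
      then have "shift (sdim S) v y \<in> points S"
        using S y(1) by (auto simp: subshift_def)
      moreover have "shift (sdim S) v y u = g (shift d v x u)" if u: "u \<in> rect d m n" for u
      proof -
        have "padd u v \<in> rect d (padd m v) (padd n v)"
          using u v by (auto simp: rect_def padd_def Zd_def)
        moreover have "u \<in> Zd d" "u \<in> Zd (sdim S)"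
          using u rect_subset_Zd d Zd_mono by blast+
        ultimately show ?thesis
          using y(2) by (auto simp: shift_def)
      qed
      ultimately show ?thesis by blast
    qed
    ultimately show ?thesis by (auto simp: pullback_def)
  qed
  ultimately show ?thesis
    unfolding subshift_def by (simp add: pullback_def)
qed

lemma lang_pullback:
  assumes "d \<le> sdim S" "g ` A \<subseteq> alphabet S" "w \<in> lang (pullback g A d S)"
  shows "subst g w \<in> lang S"
proof -
  obtain x where w: "w \<in> words A d" and x: "x \<in> points (pullback g A d S)"
    and wx: "\<forall>u\<in>dom w. w u = Some (x u)"
    using assms(3) unfolding lang_iff by (auto simp: pullback_def)
  obtain m n where mn: "dom w = rect d m n" using w by (auto simp: words_def)
  obtain y where y: "y \<in> points S" "\<forall>u\<in>rect d m n. y u = g (x u)"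
    using x unfolding pullback_def by simp meson
  have "subst g w \<in> words (alphabet S) (sdim S)"
    using subst_words[OF w assms(2)] words_mono[OF order_refl assms(1)] by blast
  then show ?thesis
    unfolding lang_iff using y wx mn by (auto simp: subst_Some intro!: bexI[of _ y])
qed

lemma lang_pullbackI:
  assumes w: "w \<in> words A d" and d: "d \<le> sdim S"
    and y: "y \<in> points S" "y ` Zd d \<subseteq> g ` A" "\<forall>u\<in>dom w. subst g w u = Some (y u)"
  shows "w \<in> lang (pullback g A d S)"
proof -
  define x where
    "x = (\<lambda>u\<in>Zd d. if u \<in> dom w then the (w u) else SOME a. a \<in> A \<and> g a = y u)"
  have x: "x u \<in> A \<and> g (x u) = y u" if u: "u \<in> Zd d" for u
  proof (cases "u \<in> dom w")
    case True
    then obtain a where a: "w u = Some a" by blast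
    then have "a \<in> A" using w by (auto simp: words_def ran_def)
    moreover have "g a = y u" using y(3) True subst_Some[of w u a g, OF a] by simp
    ultimately show ?thesis using a True u by (simp add: x_def)
  next
    case False
    have "\<exists>a. a \<in> A \<and> g a = y u" using y(2) u by force
    from someI_ex[OF this] show ?thesis using False u by (simp add: x_def)
  qed
  have "x \<in> points (pullback g A d S)"
    using x y(1) rect_subset_Zd by (fastforce simp: pullback_def x_def)
  moreover have "\<forall>u\<in>dom w. w u = Some (x u)"
    using dom_words[OF w] by (auto simp: x_def)
  ultimately show ?thesis
    unfolding lang_iff using w by (auto simp: pullback_def)
qed

lemma consistentI_any_extension:
  fixes M :: "'a shift_space" and S :: "'c shift_space"
  assumes M: "subshift M"
    and U: "finite U" and UV: "U \<union> V \<subseteq> words (alphabet M <+> UNIV) (sdim M)"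
    and \<iota>: "inj_on \<iota> (alphabet M)"
    and S: "subshift S" and ext: "relabel \<iota> M \<sqsubseteq> S" and sat: "satisfied \<iota> S U V"
  shows "consistent M U V"
proof -
  let ?d = "sdim M"
  have d: "?d \<le> sdim S" and alph: "\<iota> ` alphabet M \<subseteq> alphabet S"
    and lng: "lang S \<inter> words (\<iota> ` alphabet M) ?d = lang (relabel \<iota> M)"
    using ext by (auto simp: extended_by_def relabel_def)
  obtain \<beta> where \<beta>: "\<beta> ` sys_vars (U \<union> V) \<subseteq> alphabet S"
    and mod: "models S (subst (case_sum \<iota> \<beta>) ` U) (subst (case_sum \<iota> \<beta>) ` V)"
    using sat by (auto simp: satisfied_def)
  have "\<exists>y. y \<in> points S \<and> (\<forall>u\<in>dom w. subst (case_sum \<iota> \<beta>) w u = Some (y u))" if "w \<in> U" for w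
    using mod that by (fastforce simp: models_def lang_iff)
  then obtain Y where Y: "\<And>w. w \<in> U \<Longrightarrow> Y w \<in> points S"
    "\<And>w u. w \<in> U \<Longrightarrow> u \<in> dom w \<Longrightarrow> subst (case_sum \<iota> \<beta>) w u = Some (Y w u)"
    by metis
  define D where "D = \<beta> ` sys_vars (U \<union> V) \<union> (\<Union>w\<in>U. Y w ` Zd ?d)"
  have D: "countable D" unfolding D_def using U
    by (intro countable_Un countable_UN countable_image countable_Zd countableI_type countable_finite)
  have "Y w ` Zd ?d \<subseteq> alphabet S" if "w \<in> U" for w
    using points_PiE[OF S Y(1)[OF that]] Zd_mono[OF d] by blast
  then have DS: "D \<subseteq> alphabet S" unfolding D_def using \<beta> by blast
  define g where "g = case_sum \<iota> (from_nat_into D)"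
  define A where "A = alphabet M <+> (if D = {} then {} else UNIV :: nat set)"
  have gA: "g ` A = \<iota> ` alphabet M \<union> D"
    using range_from_nat_into[OF _ D] by (auto simp: g_def A_def Plus_def image_Un image_image)
  then have gAS: "g ` A \<subseteq> alphabet S" using alph DS by blast
  define T where "T = pullback g A ?d S"
  have T: "subshift T" unfolding T_def by (rule subshift_pullback[OF S d])
  have TA: "alphabet T = A" "sdim T = ?d" by (auto simp: T_def pullback_def)
  have langT: "subst g w \<in> lang S" if "w \<in> lang T" for w
    using lang_pullback[OF d gAS] that unfolding T_def .

  have "relabel Inl M \<sqsubseteq> T"
    unfolding extended_by_def
  proof (intro conjI)
    show "alphabet (relabel Inl M) \<subseteq> alphabet T" by (auto simp: TA A_def relabel_def)
    show "sdim (relabel Inl M) \<le> sdim T" by (simp add: TA relabel_def)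
    show "lang T \<inter> words (alphabet (relabel Inl M)) (sdim (relabel Inl M)) = lang (relabel Inl M)"
    proof (intro equalityI subsetI)
      fix w assume w: "w \<in> lang T \<inter> words (alphabet (relabel Inl M)) (sdim (relabel Inl M))"
      then have w1: "w \<in> words (Inl ` alphabet M) ?d" by (simp add: relabel_def)
      define w0 where "w0 = subst projl w"
      have w0: "w0 \<in> words (alphabet M) ?d"
        unfolding w0_def by (rule subst_words[OF w1]) auto
      have eq: "w = subst Inl w0"
      proof
        fix u show "w u = subst Inl w0 u"
          using w1 by (cases "w u") (auto simp: w0_def subst_def words_def ran_def)
      qed
      have "subst g w = subst \<iota> w0"
        by (simp add: eq subst_subst g_def comp_def)
      then have "subst \<iota> w0 \<in> lang (relabel \<iota> M)"
        using langT[of w] w lng subst_words[OF w0, of \<iota>] by auto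
      then obtain w' where w': "w' \<in> lang M" "subst \<iota> w0 = subst \<iota> w'"
        using lang_relabelD[OF M] by metis
      have "w0 = w'"
        by (rule subst_inj_on[OF \<iota> _ _ w'(2)]) (use w0 w'(1) in \<open>auto simp: words_def lang_iff\<close>)
      then show "w \<in> lang (relabel Inl M)"
        using lang_relabel[OF w'(1)] eq by simp
    next
      fix w :: "('a + nat) word" assume "w \<in> lang (relabel Inl M)"
      then obtain w0 where w0: "w0 \<in> lang M" and eq: "w = subst Inl w0"
        using lang_relabelD[OF M] by metis
      obtain x where w0w: "w0 \<in> words (alphabet M) ?d" and x: "x \<in> points M"
        and wx: "\<forall>u\<in>dom w0. w0 u = Some (x u)"
        using w0 by (auto simp: lang_iff)
      have xP: "x \<in> Zd ?d \<rightarrow>\<^sub>E alphabet M" by (rule points_PiE[OF M x])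
      define z :: "point \<Rightarrow> 'a + nat" where "z = (\<lambda>u\<in>Zd ?d. Inl (x u))"
      have "\<exists>y\<in>points S. \<forall>u\<in>rect ?d m n. y u = g (z u)" for m n
      proof -
        define m' where "m' = (\<lambda>i. min (m i) (n i))"
        define v where "v = (\<lambda>u. Some (x u)) |` rect ?d m' n"
        have dv: "dom v = rect ?d m' n" by (auto simp: v_def)
        have "ran v \<subseteq> alphabet M"
          using xP rect_subset_Zd by (fastforce simp: v_def ran_def restrict_map_def split: if_splits)
        then have "v \<in> words (alphabet M) ?d"
          unfolding words_def mem_Collect_eq using dv
          by (intro conjI exI[of _ m'] exI[of _ n]) (simp_all add: m'_def)
        then have "v \<in> lang M"
          unfolding lang_iff using x by (auto simp: v_def)
        then have "subst \<iota> v \<in> lang S" using lang_relabel lng by blast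
        then obtain y where y: "y \<in> points S" "\<forall>u\<in>dom v. subst \<iota> v u = Some (y u)"
          by (auto simp: lang_iff)
        have "y u = g (z u)" if "u \<in> rect ?d m n" for u
        proof -
          have u: "u \<in> rect ?d m' n" using that by (force simp: rect_def m'_def)
          then have "v u = Some (x u)" by (simp add: v_def)
          moreover have "u \<in> Zd ?d" using u rect_subset_Zd by blast
          ultimately show ?thesis using y(2) u dv by (auto simp: subst_Some g_def z_def)
        qed
        then show ?thesis using y(1) by blast
      qed
      then have "z \<in> points T"
        using xP by (auto simp: T_def pullback_def z_def A_def)
      moreover have "w \<in> words (Inl ` alphabet M) ?d"
        unfolding eq by (rule subst_words[OF w0w]) simp
      moreover have "words (Inl ` alphabet M) ?d \<subseteq> words A ?d"
        by (rule words_mono) (auto simp: A_def)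
      moreover have "\<forall>u\<in>dom w. w u = Some (z u)"
        using wx dom_words[OF w0w] by (auto simp: eq z_def subst_Some)
      ultimately show "w \<in> lang T \<inter> words (alphabet (relabel Inl M)) (sdim (relabel Inl M))"
        by (auto simp: lang_iff TA relabel_def)
    qed
  qed

  moreover have "satisfied Inl T U V"
  proof -
    define \<gamma> :: "nat \<Rightarrow> 'a + nat" where "\<gamma> = (\<lambda>i. Inr (to_nat_on D (\<beta> i)))"
    have g\<gamma>: "g (\<gamma> i) = \<beta> i" if "i \<in> sys_vars (U \<union> V)" for i
      using that D by (auto simp: g_def \<gamma>_def D_def intro!: from_nat_into_to_nat_on)
    have \<gamma>A: "\<gamma> i \<in> A" if "i \<in> sys_vars (U \<union> V)" for i
      using that by (auto simp: \<gamma>_def A_def D_def)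
    have wA: "subst (case_sum Inl \<gamma>) w \<in> words A ?d" if "w \<in> U \<union> V" for w
    proof -
      have w: "w \<in> words (alphabet M <+> UNIV) ?d" using UV that by blast
      have "case_sum Inl \<gamma> a \<in> A" if "a \<in> ran w" for a
      proof (cases a)
        case (Inl b)
        then show ?thesis using w that by (auto simp: words_def A_def)
      next
        case (Inr i)
        then have "i \<in> sys_vars (U \<union> V)" using that \<open>w \<in> U \<union> V\<close> by (auto simp: sys_vars_def)
        then show ?thesis using \<gamma>A Inr by simp
      qed
      then show ?thesis using w unfolding words_def by auto
    qed
    have gw: "subst g (subst (case_sum Inl \<gamma>) w) = subst (case_sum \<iota> \<beta>) w" if "w \<in> U \<union> V" for w
    proof
      fix u show "subst g (subst (case_sum Inl \<gamma>) w) u = subst (case_sum \<iota> \<beta>) w u"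
      proof (cases "w u")
        case (Some a)
        show ?thesis
        proof (cases a)
          case (Inl b)
          then show ?thesis using Some by (simp add: subst_def g_def)
        next
          case (Inr i)
          then have "i \<in> sys_vars (U \<union> V)"
            using Some that by (auto simp: sys_vars_def ran_def)
          then show ?thesis using Some Inr g\<gamma> by (simp add: subst_def)
        qed
      qed (simp add: subst_def)
    qed
    have "subst (case_sum Inl \<gamma>) w \<in> lang T" if w: "w \<in> U" for w
      unfolding T_def
    proof (rule lang_pullbackI[OF wA d Y(1)[OF w]])
      show "Y w ` Zd ?d \<subseteq> g ` A" using w by (auto simp: gA D_def)
      show "\<forall>u\<in>dom (subst (case_sum Inl \<gamma>) w).
              subst g (subst (case_sum Inl \<gamma>) w) u = Some (Y w u)"
        using gw[of w] Y(2)[OF w] w by auto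
    qed (use w in auto)
    moreover have "subst (case_sum Inl \<gamma>) w \<in> colang T" if w: "w \<in> V" for w
    proof -
      have "subst (case_sum \<iota> \<beta>) w \<notin> lang S"
        using mod w by (auto simp: models_def colang_iff)
      then show ?thesis
        using langT[of "subst (case_sum Inl \<gamma>) w"] gw[of w] wA[of w] w by (auto simp: colang_iff TA)
    qed
    ultimately show ?thesis
      unfolding satisfied_def models_def using \<gamma>A by (intro exI[of _ \<gamma>]) (auto simp: TA)
  qed
  moreover have "sys_consts (U \<union> V) \<subseteq> alphabet M"
    using UV by (fastforce simp: sys_consts_def words_def)
  ultimately show ?thesis
    using T unfolding consistent_def by blast
qed

end

theory Submission
  imports Defs
begin

text \<open>
  A single existentially closed subshift \<open>M\<close> defeats every candidate at once: for each finite set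
  \<open>F\<close> of letters, the words over \<open>F\<close> in the language of \<open>M\<close> have bounded size. A nonempty subshift
  of dimension at least 1 in a finite alphabet has arbitrarily large words, so no injective image of
  it is induced in \<open>M\<close>.

  Such an \<open>M\<close> exists because existential closure only ever asks for finitely many finite words, and
  nothing forces the surroundings of these words to repeat a letter. The space \<open>M\<close> is built in
  countably many stages, each with its own infinite supply of fresh letters. At stage \<open>t\<close> a finite
  set of words is considered, whose constants are letters of earlier stages and whose variables are
  read as fresh letters. If the words create no pattern over old letters that is not there already
  (they are \<^emph>\<open>conservative\<close>), each is completed to a full configuration by filling the rest of
  \<open>\<int>\<^sup>d\<close> with fresh letters, pairwise distinct. Two consequences carry the proof.

  \<^item> Boundedness (\<open>bounded_words\<close>). By conservativity the language over the letters older than \<open>t\<close>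
    never changes from stage \<open>t\<close> on (\<open>occurs_stage_old\<close>). By then there are finitely many
    configurations, each injective outside a finite set, so each meets \<open>F\<close> in finitely many places.

  \<^item> Existential closure (\<open>existentially_closed_ec_space\<close>). Suppose that an extension \<open>S\<close> of \<open>M\<close>
    satisfies a system with positive part \<open>U\<close> and negative part \<open>V\<close>. The words realising \<open>U\<close> in \<open>S\<close>,
    with letters outside \<open>M\<close> turned into variables, are conservative since \<open>S\<close> has no patterns over
    the letters of \<open>M\<close> beyond those of \<open>M\<close>. So some stage adds them. A word of \<open>V\<close> cannot become
    permitted: it contains no filling letter, so it would be a pattern of an earlier stage or a factor
    of one of the added words, and in both cases it would occur in \<open>S\<close>. This is why the stages
    treat sets of positive words only.

  The argument covers \<open>d = 0\<close>, where no room is left for filling letters: there \<open>M\<close> only has to exist,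
  since a subshift of positive dimension does not embed in one of dimension 0.
\<close>

section \<open>Subshifts generated by a set of configurations\<close>

definition occurs :: "nat \<Rightarrow> 'a word \<Rightarrow> (point \<Rightarrow> 'a) set \<Rightarrow> bool" where
  "occurs d w X \<longleftrightarrow> (\<exists>y\<in>X. \<exists>v\<in>Zd d. \<forall>u\<in>dom w. w u = Some (y (padd u v)))"

text \<open>
  The closure of all translates of \<open>X\<close>, restricted to \<open>\<int>\<^sup>d\<close>. Elements of \<open>X\<close> may take any values
  outside \<open>Zd d\<close>, which spares them the extensionality required of points.
\<close>

definition generated :: "'a set \<Rightarrow> nat \<Rightarrow> (point \<Rightarrow> 'a) set \<Rightarrow> 'a shift_space" where
  "generated A d X =
     \<lparr>alphabet = A, sdim = d,
      points = {x \<in> Zd d \<rightarrow>\<^sub>E A. \<forall>m n. \<exists>y\<in>X. \<exists>v\<in>Zd d. \<forall>u\<in>rect d m n. x u = y (padd u v)}\<rparr>"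

lemma generated_simps [simp]:
  "alphabet (generated A d X) = A" "sdim (generated A d X) = d"
  by (simp_all add: generated_def)

lemma padd_Zd: "u \<in> Zd d \<Longrightarrow> v \<in> Zd d \<Longrightarrow> padd u v \<in> Zd d"
  by (simp add: Zd_def padd_def)

lemma padd_assoc: "padd (padd u v) w = padd u (padd v w)"
  by (simp add: padd_def fun_eq_iff)

lemma inj_padd: "inj (\<lambda>u. padd u v)"
  by (auto simp: inj_on_def padd_def fun_eq_iff)

lemma occurs_Un: "occurs d w (X \<union> Y) \<longleftrightarrow> occurs d w X \<or> occurs d w Y"
  by (simp add: occurs_def bex_Un)

lemma occurs_mono: "occurs d w X \<Longrightarrow> X \<subseteq> Y \<Longrightarrow> occurs d w Y"
  by (auto simp: occurs_def)

text \<open>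
  A configuration outside the set has a bad rectangle, and agreement on a finite rectangle is an
  open condition; translating a point translates the rectangles on which it is tested.
\<close>

lemma subshift_generated: "subshift (generated A d X)"
proof -
  let ?P = "points (generated A d X)"
  let ?T = "product_topology (\<lambda>_. discrete_topology A) (Zd d)"
  have "openin ?T ((Zd d \<rightarrow>\<^sub>E A) - ?P)"
  proof (subst openin_subopen, intro ballI)
    fix x assume x: "x \<in> (Zd d \<rightarrow>\<^sub>E A) - ?P"
    then obtain m n where
      mn: "\<not> (\<exists>y\<in>X. \<exists>v\<in>Zd d. \<forall>u\<in>rect d m n. x u = y (padd u v))"
      by (auto simp: generated_def)
    define N where "N = (\<lambda>u. if u \<in> rect d m n then {x u} else A)"
    have "openin ?T (PiE (Zd d) N)"
    proof (rule product_topology_basis)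
      show "openin (discrete_topology A) (N u)" for u
        using x rect_subset_Zd[of d m n] by (auto simp: N_def)
      have "{u. N u \<noteq> topspace (discrete_topology A)} \<subseteq> rect d m n"
        by (auto simp: N_def)
      then show "finite {u. N u \<noteq> topspace (discrete_topology A)}"
        using finite_rect finite_subset by blast
    qed
    moreover have "x \<in> PiE (Zd d) N"
      using x by (auto simp: N_def PiE_iff)
    moreover have "PiE (Zd d) N \<subseteq> (Zd d \<rightarrow>\<^sub>E A) - ?P"
    proof
      fix z assume z: "z \<in> PiE (Zd d) N"
      have eq: "z u = x u" if "u \<in> rect d m n" for u
        using z that rect_subset_Zd[of d m n] by (force simp: N_def PiE_iff)
      have "N u \<subseteq> A" if "u \<in> Zd d" for u
        using x that by (auto simp: N_def)
      then have "z \<in> Zd d \<rightarrow>\<^sub>E A"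
        using z PiE_mono[of "Zd d" N "\<lambda>_. A"] by blast
      moreover have "z \<notin> ?P"
        using mn eq by (simp add: generated_def) metis
      ultimately show "z \<in> (Zd d \<rightarrow>\<^sub>E A) - ?P" by blast
    qed
    ultimately show "\<exists>W. openin ?T W \<and> x \<in> W \<and> W \<subseteq> (Zd d \<rightarrow>\<^sub>E A) - ?P" by blast
  qed
  then have "closedin ?T ?P"
    unfolding closedin_def by (auto simp: generated_def)
  moreover have "shift d v x \<in> ?P" if v: "v \<in> Zd d" and x: "x \<in> ?P" for v x
  proof -
    have "x \<in> Zd d \<rightarrow> A" using x by (auto simp: generated_def)
    then have "shift d v x \<in> Zd d \<rightarrow>\<^sub>E A"
      unfolding shift_def using padd_Zd[OF _ v] by (intro restrict_PiE_iff[THEN iffD2]) blast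
    moreover have "\<exists>y\<in>X. \<exists>v'\<in>Zd d. \<forall>u\<in>rect d m n. shift d v x u = y (padd u v')" for m n
    proof -
      have "\<exists>y\<in>X. \<exists>v'\<in>Zd d. \<forall>u\<in>rect d (padd m v) (padd n v). x u = y (padd u v')"
        using x by (simp add: generated_def)
      then obtain y v' where y: "y \<in> X" "v' \<in> Zd d"
        "\<forall>u\<in>rect d (padd m v) (padd n v). x u = y (padd u v')" by blast
      have "shift d v x u = y (padd u (padd v v'))" if u: "u \<in> rect d m n" for u
      proof -
        have "padd u v \<in> rect d (padd m v) (padd n v)"
          using u v by (auto simp: rect_def padd_def Zd_def)
        then show ?thesis
          using y(3) subsetD[OF rect_subset_Zd u] by (simp add: shift_def padd_assoc)
      qed
      then show ?thesis using y(1,2) v padd_Zd by blast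
    qed
    ultimately show ?thesis by (auto simp: generated_def)
  qed
  ultimately show ?thesis
    by (simp add: subshift_def)
qed

text \<open>Passing to the closure adds points but no words, because a word sees only a finite rectangle.\<close>

lemma lang_generated:
  assumes X: "\<And>y p. y \<in> X \<Longrightarrow> p \<in> Zd d \<Longrightarrow> y p \<in> A"
  shows "w \<in> lang (generated A d X) \<longleftrightarrow> w \<in> words A d \<and> occurs d w X"
proof (intro iffI conjI)
  assume w: "w \<in> lang (generated A d X)"
  then show "w \<in> words A d" by (simp add: lang_iff)
  obtain x where x: "x \<in> points (generated A d X)" "\<forall>u\<in>dom w. w u = Some (x u)"
    using w by (auto simp: lang_iff)
  obtain m n where "dom w = rect d m n"
    using \<open>w \<in> words A d\<close> by (auto simp: words_def)
  moreover have "\<exists>y\<in>X. \<exists>v\<in>Zd d. \<forall>u\<in>rect d m n. x u = y (padd u v)"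
    using x(1) by (simp add: generated_def)
  ultimately show "occurs d w X"
    using x(2) by (simp add: occurs_def)
next
  assume w: "w \<in> words A d \<and> occurs d w X"
  then obtain y v where y: "y \<in> X" "v \<in> Zd d" "\<forall>u\<in>dom w. w u = Some (y (padd u v))"
    by (auto simp: occurs_def)
  let ?x = "\<lambda>u\<in>Zd d. y (padd u v)"
  have "?x \<in> Zd d \<rightarrow>\<^sub>E A"
    using X[OF y(1)] padd_Zd[OF _ y(2)] by simp
  moreover have "?x u = y (padd u v)" if "u \<in> rect d m n" for u m n
    using that rect_subset_Zd by auto
  ultimately have "?x \<in> points (generated A d X)"
    using y(1,2) by (auto simp: generated_def)
  moreover have "\<forall>u\<in>dom w. w u = Some (?x u)"
    using w y(3) dom_words[of w A d] by auto
  ultimately show "w \<in> lang (generated A d X)"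
    using w unfolding lang_iff generated_simps by blast
qed

lemma subst_SomeD: "subst f w u = Some b \<Longrightarrow> \<exists>a. w u = Some a \<and> f a = b"
  by (auto simp: subst_def)

lemma lang_factor:
  assumes S: "subshift S" and z: "z \<in> lang S" and w: "w \<in> words (alphabet S) (sdim S)"
    and v: "v \<in> Zd (sdim S)" and wz: "\<And>q. q \<in> dom w \<Longrightarrow> w q = z (padd q v)"
  shows "w \<in> lang S"
proof -
  obtain x where x: "x \<in> points S" "\<forall>u\<in>dom z. z u = Some (x u)"
    using z by (auto simp: lang_iff)
  have "shift (sdim S) v x \<in> points S"
    using S v x(1) by (simp add: subshift_def)
  moreover have "w q = Some (shift (sdim S) v x q)" if "q \<in> dom w" for q
  proof -
    have "padd q v \<in> dom z" using wz[OF that] that by (metis domIff)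
    then show ?thesis
      using x(2) wz[OF that] dom_words[OF w] that by (auto simp: shift_def)
  qed
  ultimately show ?thesis using w by (auto simp: lang_iff)
qed

section \<open>Enumerating finite sets of words\<close>

lemma words_finite_dom: "w \<in> words A d \<Longrightarrow> finite (dom w)"
  by (auto simp: words_def finite_rect)

text \<open>A word is determined by its graph, a finite set of pairs.\<close>

lemma countable_words:
  assumes "countable A"
  shows "countable (words A d)"
proof (rule countable_image_inj_on)
  have "Map.graph ` words A d \<subseteq> {G. finite G \<and> G \<subseteq> Zd d \<times> A}"
  proof
    fix G assume "G \<in> Map.graph ` words A d"
    then obtain w where w: "w \<in> words A d" "G = Map.graph w" by blast
    then have "finite G"
      by (simp add: finite_graph_iff_finite_dom words_finite_dom)
    moreover have "G \<subseteq> Zd d \<times> A"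
      using w dom_words[OF w(1)] by (auto simp: words_def Map.graph_def ran_def)
    ultimately show "G \<in> {G. finite G \<and> G \<subseteq> Zd d \<times> A}" by blast
  qed
  moreover have "countable {G. finite G \<and> G \<subseteq> Zd d \<times> A}"
    by (intro countable_Collect_finite_subset countable_SIGMA countable_Zd assms)
  ultimately show "countable (Map.graph ` words A d)"
    using countable_subset by blast
  show "inj_on Map.graph (words A d)"
  proof (rule inj_onI)
    fix w w' :: "'a word" assume eq: "Map.graph w = Map.graph w'"
    have "w u = Some a \<longleftrightarrow> w' u = Some a" for u a
      using eq unfolding Map.graph_def by blast
    then show "w = w'" by (metis ext not_None_eq)
  qed
qed

text \<open>
  Arbitrarily late repetition lets a set of words wait until all its constants have become old.
  Pairing every element with every natural number provides it, as \<open>prod_encode (i, n) \<ge> n\<close>.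
\<close>

lemma enumerate_infinitely_often:
  assumes "countable X" "X \<noteq> {}"
  shows "\<exists>e :: nat \<Rightarrow> 'a. (\<forall>k. e k \<in> X) \<and> (\<forall>x\<in>X. \<forall>n. \<exists>k\<ge>n. e k = x)"
proof (intro exI conjI allI ballI)
  let ?e = "\<lambda>k. from_nat_into X (fst (prod_decode k))"
  show "?e k \<in> X" for k using from_nat_into[OF assms(2)] .
  fix x n assume "x \<in> X"
  then show "n \<le> prod_encode (to_nat_on X x, n)" "?e (prod_encode (to_nat_on X x, n)) = x"
    using assms by (simp_all add: le_prod_encode_2)
qed

section \<open>A staged construction with distinct filling letters\<close>

text \<open>
  The letters \<open>letter t (Inl i)\<close> realise the variables of the task at stage \<open>t\<close>, and the letters
  \<open>letter t (Inr j)\<close> fill the positions around its words. The bookkeeping lists every finite set of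
  words over letters and variables arbitrarily late.
\<close>

locale staged_alphabet =
  fixes d :: nat and letter :: "nat \<Rightarrow> nat + nat \<Rightarrow> 'm"
    and task :: "nat \<Rightarrow> ('m + nat) word set"
  assumes letter_eq_iff: "letter s i = letter t j \<longleftrightarrow> s = t \<and> i = j"
    and finite_task: "finite (task t)"
    and task_cofinal: "\<lbrakk>finite U; U \<subseteq> words ((\<Union>s. range (letter s)) <+> UNIV) d\<rbrakk> \<Longrightarrow>
          \<exists>t\<ge>n. task t = U"
begin

definition old :: "nat \<Rightarrow> 'm set" where
  "old t = (\<Union>s<t. range (letter s))"

definition letters :: "'m set" where
  "letters = (\<Union>s. range (letter s))"

definition reading :: "nat \<Rightarrow> 'm + nat \<Rightarrow> 'm" where
  "reading t = case_sum id (letter t \<circ> Inl)"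

text \<open>
  Filling letters are indexed by their position, so they are pairwise distinct within a
  configuration. Different words of one task may share them, because boundedness counts places in one
  configuration at a time.
\<close>

definition pad :: "nat \<Rightarrow> ('m + nat) word \<Rightarrow> point \<Rightarrow> 'm" where
  "pad t w p = (case w p of Some a \<Rightarrow> reading t a | None \<Rightarrow> letter t (Inr (to_nat_on (Zd d) p)))"

text \<open>
  Occurrence is tested in the padded configurations; as filling letters are not old, this concerns
  only factors of the words themselves.
\<close>

definition conservative :: "nat \<Rightarrow> (point \<Rightarrow> 'm) set \<Rightarrow> bool" where
  "conservative t X \<longleftrightarrow> task t \<subseteq> words (old t <+> UNIV) d \<and>
     (\<forall>w\<in>words (old t) d. occurs d w (pad t ` task t) \<longrightarrow> occurs d w X)"

primrec stage :: "nat \<Rightarrow> (point \<Rightarrow> 'm) set" where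
  "stage 0 = {}"
| "stage (Suc t) = stage t \<union> (if conservative t (stage t) then pad t ` task t else {})"

definition ec_space :: "'m shift_space" where
  "ec_space = generated letters d (\<Union>t. stage t)"

lemma old_mono: "s \<le> t \<Longrightarrow> old s \<subseteq> old t"
  unfolding old_def by (intro UN_mono) auto

lemma old_Suc: "old (Suc t) = old t \<union> range (letter t)"
  by (auto simp: old_def lessThan_Suc)

lemma old_subset_letters: "old t \<subseteq> letters"
  by (auto simp: old_def letters_def)

lemma letter_in_letters: "letter t i \<in> letters"
  by (auto simp: letters_def)

lemma letter_notin_old: "letter t i \<notin> old t"
  by (auto simp: old_def letter_eq_iff)

lemma finite_subset_old:
  assumes "finite F" "F \<subseteq> letters"
  shows "\<exists>t. F \<subseteq> old t"
  using assms
proof (induction F rule: finite_induct)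
  case (insert a F)
  then obtain t where t: "F \<subseteq> old t" by blast
  obtain s i where "a = letter s i" using insert.prems by (auto simp: letters_def)
  then have "a \<in> old (Suc s)" by (auto simp: old_def)
  then have "insert a F \<subseteq> old (max t (Suc s))"
    using t old_mono[of t "max t (Suc s)"] old_mono[of "Suc s" "max t (Suc s)"] by auto
  then show ?case by blast
qed simp

lemma stage_mono: "s \<le> t \<Longrightarrow> stage s \<subseteq> stage t"
  by (rule lift_Suc_mono_le[of stage]) auto

lemma stage_letters: "y \<in> stage t \<Longrightarrow> p \<in> Zd d \<Longrightarrow> y p \<in> old t"
proof (induction t)
  case (Suc t)
  show ?case
  proof (cases "y \<in> stage t")
    case True
    then show ?thesis using Suc old_mono[of t "Suc t"] by auto
  next
    case False
    then obtain w where w: "y = pad t w" "w \<in> words (old t <+> UNIV) d"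
      using Suc.prems by (auto simp: conservative_def split: if_splits)
    then have "a \<in> old t <+> UNIV" if "w p = Some a" for a
      using that by (auto simp: words_def ran_def)
    then show ?thesis
      unfolding w(1) pad_def reading_def old_Suc by (cases "w p") auto
  qed
qed simp

text \<open>Conservativity freezes the patterns over the letters older than \<open>t\<close> at stage \<open>t\<close>.\<close>

lemma occurs_stage_old:
  assumes "w \<in> words (old t) d" "occurs d w (stage s)"
  shows "occurs d w (stage t)"
proof (cases "s \<le> t")
  case True
  then show ?thesis using assms(2) stage_mono occurs_mono by blast
next
  case False
  then have "t \<le> s" by simp
  then show ?thesis using assms(2)
  proof (induction s rule: dec_induct)
    case (step n)
    have "w \<in> words (old n) d"
      using assms(1) words_mono[OF old_mono[OF step(1)] order_refl] by blast
    then have "occurs d w (stage n)"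
      using step.prems
      by (cases "conservative n (stage n)") (simp_all add: occurs_Un, metis conservative_def)
    then show ?case by (rule step.IH)
  qed
qed

lemma lang_ec_space: "w \<in> lang ec_space \<longleftrightarrow> w \<in> words letters d \<and> occurs d w (\<Union>t. stage t)"
  unfolding ec_space_def
  by (rule lang_generated) (use stage_letters old_subset_letters in blast)

lemma lang_ec_space_old:
  assumes "w \<in> words (old t) d" "w \<in> lang ec_space"
  shows "occurs d w (stage t)"
proof -
  obtain s where "occurs d w (stage s)"
    using assms(2) by (auto simp: lang_ec_space occurs_def)
  then show ?thesis using occurs_stage_old assms(1) by blast
qed

text \<open>
  Outside the domain of the padded word there are only filling letters.
\<close>

lemma occurs_padD:
  assumes "occurs d w (pad t ` W)" "ran w \<subseteq> old t \<union> range (letter t \<circ> Inl)"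
  obtains u v where "u \<in> W" "v \<in> Zd d" "\<And>q. q \<in> dom w \<Longrightarrow> w q = subst (reading t) u (padd q v)"
proof -
  obtain u v where uv: "u \<in> W" "v \<in> Zd d" "\<forall>q\<in>dom w. w q = Some (pad t u (padd q v))"
    using assms(1) by (auto simp: occurs_def)
  have "w q = subst (reading t) u (padd q v)" if "q \<in> dom w" for q
  proof (cases "u (padd q v)")
    case None
    then have "w q = Some (letter t (Inr (to_nat_on (Zd d) (padd q v))))"
      using uv(3) that by (simp add: pad_def)
    then have "letter t (Inr (to_nat_on (Zd d) (padd q v))) \<in> ran w"
      by (blast intro: ranI)
    then show ?thesis using assms(2) letter_notin_old by (auto simp: letter_eq_iff)
  next
    case (Some a)
    then show ?thesis using uv(3) that by (auto simp: pad_def subst_Some)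
  qed
  then show ?thesis using that uv(1,2) by blast
qed

lemma finite_fibre_pad:
  assumes "finite (dom w)" "finite F"
  shows "finite {p \<in> Zd d. pad t w p \<in> F}"
proof -
  have "inj_on (pad t w) (Zd d - dom w)"
    by (auto simp: inj_on_def pad_def letter_eq_iff domIff countable_Zd)
  then have "finite (pad t w -` F \<inter> (Zd d - dom w))"
    using assms(2) by (rule finite_vimage_IntI[rotated])
  then have "finite (dom w \<union> (pad t w -` F \<inter> (Zd d - dom w)))"
    using assms(1) by simp
  then show ?thesis by (rule rev_finite_subset) auto
qed

lemma finite_stage: "finite (stage t)"
  by (induction t) (auto simp: finite_task)

lemma finite_fibre_stage:
  assumes "finite F" "y \<in> stage t"
  shows "finite {p \<in> Zd d. y p \<in> F}"
  using assms(2)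
proof (induction t)
  case (Suc t)
  show ?case
  proof (cases "y \<in> stage t")
    case False
    then obtain w where "y = pad t w" "w \<in> words (old t <+> UNIV) d"
      using Suc.prems by (auto simp: conservative_def split: if_splits)
    then show ?thesis using finite_fibre_pad[OF words_finite_dom assms(1)] by blast
  qed (rule Suc.IH)
qed simp

section \<open>Words over finitely many letters are bounded\<close>

text \<open>
  All words over \<open>F\<close> occur already at a stage \<open>t\<close> by which the letters of \<open>F\<close> in use are old. There the
  places carrying a letter of \<open>F\<close> form a finite set \<open>P\<close>, into which the domain of such a word is
  translated.
\<close>

lemma bounded_words:
  assumes F: "finite F"
  shows "\<exists>N. \<forall>w\<in>lang ec_space. ran w \<subseteq> F \<longrightarrow> card (dom w) \<le> N"
proof -
  obtain t where t: "F \<inter> letters \<subseteq> old t"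
    using finite_subset_old[of "F \<inter> letters"] F by blast
  define P where "P = (\<Union>y\<in>stage t. {p \<in> Zd d. y p \<in> F})"
  have P: "finite P"
    unfolding P_def using finite_stage finite_fibre_stage[OF F] by blast
  have "card (dom w) \<le> card P" if w: "w \<in> lang ec_space" "ran w \<subseteq> F" for w
  proof -
    have wl: "w \<in> words letters d" using w(1) by (simp add: lang_ec_space)
    then have "w \<in> words (old t) d"
      using w(2) t unfolding words_def by blast
    then obtain y v where y: "y \<in> stage t" "v \<in> Zd d"
      and wy: "\<forall>u\<in>dom w. w u = Some (y (padd u v))"
      using lang_ec_space_old w(1) unfolding occurs_def by blast
    have "y (padd u v) \<in> F" if "u \<in> dom w" for u
      using wy that w(2) by (auto intro: ranI)
    moreover have "padd u v \<in> Zd d" if "u \<in> dom w" for u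
      using dom_words[OF wl] that padd_Zd[OF _ y(2)] by blast
    ultimately have "(\<lambda>u. padd u v) ` dom w \<subseteq> P"
      unfolding P_def using y(1) by blast
    then show ?thesis
      using card_inj_on_le[OF inj_on_subset[OF inj_padd subset_UNIV] _ P] by blast
  qed
  then show ?thesis by blast
qed

section \<open>Existential closure\<close>

text \<open>
  Given a solution in an extension \<open>S\<close>, the letters used there are moved into \<open>M\<close> by an injective map
  \<open>\<phi>\<close> that fixes the letters of \<open>M\<close> and sends the others to variable letters of a suitably late
  stage \<open>t\<close>. The two languages are compared by translating between factors of words of \<open>S\<close> and
  factors of their images.
\<close>

lemma existentially_closed_ec_space: "existentially_closed d ec_space"
  unfolding existentially_closed_def
proof (intro conjI allI impI)
  let ?M = ec_space
  have alph [simp]: "alphabet ?M = letters" "sdim ?M = d"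
    by (simp_all add: ec_space_def)
  show M: "subshift ?M" by (simp add: ec_space_def subshift_generated)
  show "sdim ?M = d" by simp
  fix U V :: "('m + nat) word set"
  assume "finite U \<and> finite V \<and> U \<union> V \<subseteq> words (alphabet ?M <+> UNIV) d \<and> consistent ?M U V"
  then have U: "finite U" and V: "finite V" and UV: "U \<union> V \<subseteq> words (letters <+> UNIV) d"
    and "consistent ?M U V" by auto
  then obtain S :: "('m + nat) shift_space" and \<beta> where S: "subshift S"
    and ext: "relabel Inl ?M \<sqsubseteq> S"
    and mod: "models S (subst (case_sum Inl \<beta>) ` U) (subst (case_sum Inl \<beta>) ` V)"
    by (auto simp: consistent_def satisfied_def)
  define h where "h = case_sum Inl \<beta>"
  have dS: "d \<le> sdim S" and lS: "Inl ` letters \<subseteq> alphabet S"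
    and langS: "lang S \<inter> words (Inl ` letters) d = lang (relabel Inl ?M)"
    using ext by (auto simp: extended_by_def relabel_def)
  have hU: "subst h w \<in> lang S" if "w \<in> U" for w
    using mod that by (auto simp: models_def h_def)
  have hV: "subst h w \<in> colang S" if "w \<in> V" for w
    using mod that by (auto simp: models_def h_def)

  have old_word: "w \<in> lang ?M \<longleftrightarrow> subst Inl w \<in> lang S" if "w \<in> words letters d" for w
  proof
    assume "w \<in> lang ?M"
    then show "subst Inl w \<in> lang S" using lang_relabel langS by blast
  next
    assume "subst Inl w \<in> lang S"
    moreover have "(subst Inl w :: ('m + nat) word) \<in> words (Inl ` letters) d"
      by (rule subst_words[OF that order_refl])
    ultimately have "(subst Inl w :: ('m + nat) word) \<in> lang (relabel Inl ?M)"
      unfolding langS[symmetric] by (rule IntI)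
    from lang_relabelD[OF M this] obtain w'
      where w': "w' \<in> lang ?M" "(subst Inl w :: ('m + nat) word) = subst Inl w'" .
    have "w = w'" by (rule subst_inj_on[OF inj_Inl subset_UNIV subset_UNIV w'(2)])
    then show "w \<in> lang ?M" using w'(1) by simp
  qed

  \<comment> \<open>\<open>E\<close> collects the letters of the solution in \<open>S\<close>, and \<open>k\<close> turns those outside \<open>M\<close> into
    variables. The value of a variable of the system may be such a letter or a letter of \<open>M\<close>.\<close>
  define E where "E = (\<Union>w\<in>U \<union> V. ran (subst h w))"
  have "finite (ran w)" if "w \<in> U \<union> V" for w
    using that UV by (intro finite_ran words_finite_dom) blast
  then have E: "finite E" unfolding E_def using U V by auto
  define D where "D = E - Inl ` letters"
  have D: "finite D" using E by (simp add: D_def)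
  define k where "k = (\<lambda>a. if a \<in> Inl ` letters then a else Inr (to_nat_on D a) :: 'm + nat)"
  have k_range: "k a \<in> letters <+> UNIV" for a by (auto simp: k_def)

  \<comment> \<open>The task must come when all letters of \<open>M\<close> in the solution are old.\<close>
  obtain s where s: "Inl -` E \<inter> letters \<subseteq> old s"
    using finite_subset_old[of "Inl -` E \<inter> letters"] finite_vimageI[OF E, of Inl] by auto
  have kU: "subst k (subst h w) \<in> words (letters <+> UNIV) d" if "w \<in> U \<union> V" for w
    unfolding subst_subst using that UV k_range by (intro subst_words[of w "letters <+> UNIV"]) auto
  then obtain t where st: "s \<le> t" and task: "task t = subst k ` subst h ` U"
    using task_cofinal[of "subst k ` subst h ` U" s] U unfolding letters_def by auto
  have t: "a \<in> old t" if "Inl a \<in> E" "a \<in> letters" for a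
    using s old_mono[OF st] that by blast

  define \<phi> where "\<phi> = reading t \<circ> k"
  have \<phi>_const: "\<phi> (Inl a) = a" if "a \<in> letters" for a
    using that by (simp add: \<phi>_def k_def reading_def)
  have \<phi>_new: "\<phi> a = letter t (Inl (to_nat_on D a))" if "a \<notin> Inl ` letters" for a
    using that by (simp add: \<phi>_def k_def reading_def)
  have \<phi>_letters: "\<phi> a \<in> letters" for a
    using \<phi>_const \<phi>_new by (cases "a \<in> Inl ` letters") (auto simp: letter_in_letters)
  have \<phi>_E: "\<phi> a \<in> old t \<union> range (letter t \<circ> Inl)" if "a \<in> E" for a
    using \<phi>_const \<phi>_new t that by (cases "a \<in> Inl ` letters") auto
  have \<phi>_old: "a = Inl (\<phi> a)" if "\<phi> a \<in> old t" for a
    using \<phi>_const \<phi>_new letter_notin_old that by (cases "a \<in> Inl ` letters") auto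
  have \<phi>_inj: "inj_on \<phi> E"
  proof (rule inj_onI)
    fix a b assume ab: "a \<in> E" "b \<in> E" "\<phi> a = \<phi> b"
    show "a = b"
    proof (cases "\<phi> a \<in> old t")
      case True
      then show ?thesis using \<phi>_old ab(3) by metis
    next
      case False
      then have "a \<in> D" "b \<in> D"
        using ab t \<phi>_const by (auto simp: D_def)
      moreover from this have "to_nat_on D a = to_nat_on D b"
        using ab(3) \<phi>_new by (simp add: D_def letter_eq_iff)
      ultimately show ?thesis using D by (simp add: countable_finite)
    qed
  qed
  \<comment> \<open>Letters outside \<open>M\<close> are sent to letters of stage \<open>t\<close>, which are not old.\<close>
  have \<phi>_old_word: "subst h w = subst Inl (subst \<phi> (subst h w))"
    if "ran (subst \<phi> (subst h w)) \<subseteq> old t" for w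
  proof
    fix q show "subst h w q = subst Inl (subst \<phi> (subst h w)) q"
    proof (cases "subst h w q")
      case (Some a)
      then have "a \<in> ran (subst h w)" unfolding ran_def by blast
      then have "\<phi> a \<in> old t" using that unfolding ran_subst by blast
      then have "a = Inl (\<phi> a)" by (rule \<phi>_old)
      moreover have "subst Inl (subst \<phi> (subst h w)) q = Some (Inl (\<phi> a))"
        using Some by (intro subst_Some)
      ultimately show ?thesis using Some by metis
    qed (simp add: subst_def)
  qed
  have reading_k: "subst (reading t) (subst k w) = subst \<phi> w" for w
    by (simp add: subst_subst \<phi>_def)

  \<comment> \<open>A factor over old letters of the new words is a factor of a word of \<open>S\<close>, hence a word of \<open>M\<close>,
    and those over old letters are present at stage \<open>t\<close>.\<close>
  have "conservative t (stage t)"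
    unfolding conservative_def
  proof (intro conjI ballI impI)
    have "subst k (subst h w) \<in> words (old t <+> UNIV) d" if w: "w \<in> U" for w
    proof -
      have "k a \<in> old t <+> UNIV" if "a \<in> E" for a
        using t that by (auto simp: k_def)
      moreover have "ran (subst h w) \<subseteq> E" using w by (auto simp: E_def)
      ultimately have "ran (subst k (subst h w)) \<subseteq> old t <+> UNIV"
        unfolding ran_subst[of k] by blast
      then show ?thesis using kU[of w] w unfolding words_def by blast
    qed
    then show "task t \<subseteq> words (old t <+> UNIV) d" by (auto simp: task)
    fix w assume w: "w \<in> words (old t) d" and occ: "occurs d w (pad t ` task t)"
    have "ran w \<subseteq> old t \<union> range (letter t \<circ> Inl)" using w by (auto simp: words_def)
    with occ obtain u v where u: "u \<in> U" "v \<in> Zd d"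
      and wu: "\<And>q. q \<in> dom w \<Longrightarrow> w q = subst \<phi> (subst h u) (padd q v)"
      by (rule occurs_padD) (auto simp: task reading_k)
    have wl: "w \<in> words letters d"
      using w words_mono[OF old_subset_letters order_refl] by blast
    have "subst Inl w \<in> lang S"
    proof (rule lang_factor[OF S hU[OF u(1)]])
      show "subst Inl w \<in> words (alphabet S) (sdim S)"
        using subst_words[OF wl lS] words_mono[OF order_refl dS] by blast
      show "v \<in> Zd (sdim S)" using u(2) Zd_mono[OF dS] by blast
      fix q assume "q \<in> dom (subst Inl w :: ('m + nat) word)"
      then obtain a where a: "w q = Some a" by auto
      then obtain b where b: "subst h u (padd q v) = Some b" "\<phi> b = a"
        using wu[of q] subst_SomeD[of \<phi>] by (metis domI)
      have "a \<in> old t" using a w by (auto simp: words_def ran_def)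
      then have "b = Inl a" using b(2) \<phi>_old[of b] by metis
      then show "subst Inl w q = subst h u (padd q v)"
        using b(1) subst_Some[of w q a Inl, OF a] by simp
    qed
    then show "occurs d w (stage t)"
      using old_word[OF wl] lang_ec_space_old[OF w] by blast
  qed
  then have stage: "stage (Suc t) = stage t \<union> pad t ` task t" by simp

  have \<phi>_word: "subst \<phi> (subst h w) \<in> words letters d" if "w \<in> U \<union> V" for w
    unfolding subst_subst using that UV \<phi>_letters by (intro subst_words[of w "letters <+> UNIV"]) auto

  have "subst \<phi> (subst h w) \<in> lang ?M" if w: "w \<in> U" for w
  proof -
    have "(\<lambda>_. 0) \<in> Zd d" by (simp add: Zd_def)
    moreover have "subst \<phi> (subst h w) q = Some (pad t (subst k (subst h w)) (padd q (\<lambda>_. 0)))"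
      if "q \<in> dom w" for q
      using that by (auto simp: pad_def padd_def subst_def \<phi>_def)
    moreover have "pad t (subst k (subst h w)) \<in> stage (Suc t)"
      unfolding stage task using w by blast
    ultimately have "occurs d (subst \<phi> (subst h w)) (\<Union>t. stage t)"
      unfolding occurs_def dom_subst by blast
    then show ?thesis using \<phi>_word w by (simp add: lang_ec_space)
  qed

  \<comment> \<open>An occurrence in \<open>M\<close> would appear at stage \<open>t + 1\<close>, either among the old configurations or
    inside one of the new words; both give an occurrence in \<open>S\<close>.\<close>
  moreover have "subst \<phi> (subst h w) \<in> colang ?M" if w: "w \<in> V" for w
  proof -
    let ?w = "subst \<phi> (subst h w)"
    have hw: "subst h w \<in> words (alphabet S) (sdim S)" "subst h w \<notin> lang S"
      using hV[OF w] by (auto simp: colang_iff)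
    have wE: "ran (subst h w) \<subseteq> E" using w by (auto simp: E_def)
    then have ran: "ran ?w \<subseteq> old t \<union> range (letter t \<circ> Inl)"
      using \<phi>_E by auto
    have "?w \<notin> lang ?M"
    proof
      assume lang: "?w \<in> lang ?M"
      have "?w \<in> words (old (Suc t)) d"
        using \<phi>_word[of w] w ran unfolding words_def old_Suc by auto
      then have "occurs d ?w (stage (Suc t))" using lang lang_ec_space_old by blast
      then consider "occurs d ?w (stage t)" | "occurs d ?w (pad t ` task t)"
        unfolding stage occurs_Un by blast
      then show False
      proof cases
        case 1
        then obtain y v where y: "y \<in> stage t" "v \<in> Zd d"
          "\<forall>q\<in>dom ?w. ?w q = Some (y (padd q v))" by (auto simp: occurs_def)
        have "a \<in> old t" if a: "a \<in> ran ?w" for a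
        proof -
          obtain q where q: "?w q = Some a" using a unfolding ran_def by blast
          then have "q \<in> dom ?w" unfolding dom_def by blast
          moreover have "q \<in> Zd d"
            using \<open>q \<in> dom ?w\<close> dom_words[OF \<phi>_word[of w]] w by blast
          ultimately show ?thesis
            using y(2,3) q stage_letters[OF y(1) padd_Zd] by (metis option.inject)
        qed
        then have "subst h w = subst Inl ?w" using \<phi>_old_word by blast
        then show False
          using old_word[OF \<phi>_word[of w]] w lang hw(2) by simp
      next
        case 2
        then obtain u v where u: "u \<in> U" "v \<in> Zd d"
          and wu: "\<And>q. q \<in> dom ?w \<Longrightarrow> ?w q = subst \<phi> (subst h u) (padd q v)"
          using ran by (rule occurs_padD) (auto simp: task reading_k)
        have "subst h w \<in> lang S"
        proof (rule lang_factor[OF S hU[OF u(1)] hw(1)])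
          show "v \<in> Zd (sdim S)" using u(2) Zd_mono[OF dS] by blast
          fix q assume q: "q \<in> dom (subst h w)"
          then obtain a where a: "subst h w q = Some a" by blast
          then obtain b where b: "subst h u (padd q v) = Some b" "\<phi> a = \<phi> b"
            using wu[of q] q subst_SomeD[of \<phi>] subst_Some[of "subst h w" q a \<phi>]
            by (metis dom_subst)
          have "a \<in> E" using a wE by (blast intro: ranI)
          moreover have "b \<in> E" using b(1) u(1) unfolding E_def by (blast intro: ranI)
          ultimately show "subst h w q = subst h u (padd q v)"
            using a b inj_onD[OF \<phi>_inj] by metis
        qed
        then show False using hw(2) by blast
      qed
    qed
    then show ?thesis using \<phi>_word w by (simp add: colang_iff)
  qed
  moreover have "subst (case_sum id (\<phi> \<circ> \<beta>)) w = subst \<phi> (subst h w)" if "w \<in> U \<union> V" for w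
  proof
    fix q show "subst (case_sum id (\<phi> \<circ> \<beta>)) w q = subst \<phi> (subst h w) q"
    proof (cases "w q")
      case (Some a)
      moreover have "w \<in> words (letters <+> UNIV) d" using that UV by blast
      ultimately have "a \<in> letters <+> UNIV" by (auto simp: words_def ran_def)
      then show ?thesis using Some \<phi>_const by (auto simp: subst_def h_def)
    qed (simp add: subst_def)
  qed
  ultimately show "satisfied id ?M U V"
    unfolding satisfied_def models_def using \<phi>_letters
    by (intro exI[of _ "\<phi> \<circ> \<beta>"]) auto
qed

section \<open>No finite alphabet embeds\<close>

lemma not_embeds_in_ec_space:
  assumes "finite (alphabet S)" "points S \<noteq> {}" "sdim S \<ge> 1" "subshift S"
  shows "\<not> S \<lesssim> ec_space"
proof
  assume "S \<lesssim> ec_space"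
  then obtain f where "relabel f S \<sqsubseteq> ec_space"
    by (auto simp: embeds_in_def)
  then have lang: "lang (relabel f S) \<subseteq> lang ec_space"
    by (auto simp: extended_by_def)
  obtain N where N: "\<And>w. w \<in> lang ec_space \<Longrightarrow> ran w \<subseteq> f ` alphabet S \<Longrightarrow> card (dom w) \<le> N"
    using bounded_words[of "f ` alphabet S"] assms(1) by auto
  obtain x where x: "x \<in> points S" using assms(2) by blast
  let ?R = "rect (sdim S) (\<lambda>_. 0) (\<lambda>_. int N)"
  define w where "w = (\<lambda>u. Some (x u)) |` ?R"
  have dom: "dom w = ?R" by (auto simp: w_def)
  have "ran w \<subseteq> alphabet S"
    using points_PiE[OF assms(4) x] rect_subset_Zd
    by (fastforce simp: w_def ran_def restrict_map_def split: if_splits)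
  then have w: "w \<in> words (alphabet S) (sdim S)"
    unfolding words_def mem_Collect_eq using dom
    by (intro conjI exI[of _ "\<lambda>_. 0"] exI[of _ "\<lambda>_. int N"]) simp_all
  then have "w \<in> lang S"
    unfolding lang_iff using x by (auto simp: w_def)
  then have "subst f w \<in> lang ec_space" using lang lang_relabel by blast
  then have le: "card ?R \<le> N"
    using N[of "subst f w"] w dom by (auto simp: words_def)
  \<comment> \<open>Positive dimension enters here: the \<open>N + 1\<close> places on the first axis already exceed the bound.\<close>
  let ?axis = "\<lambda>(j::nat) (i::nat). if i = 0 then int j else 0"
  have "inj_on ?axis {..N}"
    by (rule inj_onI) (metis of_nat_eq_iff)
  moreover have "?axis ` {..N} \<subseteq> ?R"
    using assms(3) by (auto simp: rect_def Zd_def)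
  ultimately have "card {..N} \<le> card ?R"
    using card_inj_on_le finite_rect by blast
  then show False using le by simp
qed

end

theorem theorem4:
  fixes d :: nat
  shows "\<not> (\<exists>S :: 'a shift_space.
            subshift S \<and> sdim S \<ge> 1 \<and> finite (alphabet S) \<and> points S \<noteq> {} \<and>
            (\<forall>M :: ('m :: infinite) shift_space. existentially_closed d M \<longrightarrow> S \<lesssim> M))"
proof -
  obtain g :: "nat \<Rightarrow> 'm" where g: "inj g"
    using infinite_countable_subset[OF infinite_UNIV] by blast
  define letter where "letter s i = g (to_nat (s, i))" for s :: nat and i :: "nat + nat"
  have letter: "letter s i = letter t j \<longleftrightarrow> s = t \<and> i = j" for s t i j
    using g by (auto simp: letter_def inj_eq)
  let ?T = "{U. finite U \<and> U \<subseteq> words ((\<Union>s. range (letter s)) <+> (UNIV :: nat set)) d}"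
  have T: "countable ?T"
    by (intro countable_Collect_finite_subset countable_words countable_Plus countable_UN
        countable_image countableI_type)
  have "{} \<in> ?T" by simp
  then have "?T \<noteq> {}" by blast
  from enumerate_infinitely_often[OF T this] obtain task :: "nat \<Rightarrow> ('m + nat) word set"
    where task: "\<forall>k. task k \<in> ?T" "\<forall>U\<in>?T. \<forall>n. \<exists>k\<ge>n. task k = U"
    by (elim exE conjE)
  interpret staged_alphabet d letter task
  proof unfold_locales
    show "letter s i = letter t j \<longleftrightarrow> s = t \<and> i = j" for s t i j by (rule letter)
    show "finite (task t)" for t using task(1) by blast
    show "\<exists>t\<ge>n. task t = U"
      if "finite U" "U \<subseteq> words ((\<Union>s. range (letter s)) <+> UNIV) d" for U n
      using task(2) that by simp
  qed
  show ?thesis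
    using existentially_closed_ec_space not_embeds_in_ec_space by blast
qed

end
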